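(* Let $J$ be a proper homogeneous ideal in $\mathcal P=\mathbb K[x_0,\ldots,x_n]$, let $s\ge 1$, and assume that $\mathcal N=\{\mathcal N_0,\ldots,\mathcal N_s\}$ is a complement of $J$ up to degree $s$. Let $\mathcal V=\mathcal V_1\cup\ldots\cup\mathcal V_s$, where for each $k=1,\ldots,s$ the set $\mathcal V_k$ is a basis of the $\mathbb K$-vector space $J_k\cap\langle\mathcal N_{k-1}^+\rangle$. Then the syzygy module $\mathrm{Syz}(\mathcal V,\mathcal N_s^+)$ of the finite family consisting of the elements of $\mathcal V$ and of $\mathcal N_s^+$ is generated, as a $\mathcal P$-module, by vectors whose entries are polynomials of degree at most $1$.
   Context: $\mathbb K$ is an algebraically closed field; $\mathcal P=\mathbb K[x_0,\ldots,x_n]$; $\mathcal T_k$ is the set of monomials of degree $k$ and $\mathcal P_k$ is its $\mathbb K$-span; for a homogeneous ideal $J$, $J_k=J\cap\mathcal P_k$. For $S\subset\mathcal P_k$, $\langle S\rangle$ denotes the $\mathbb K$-span of $S$ (with $\langle\emptyset\rangle=\{0\}$) and $S^+=\bigcup_{j=0}^n x_jS\subset\mathcal P_{k+1}$. Complement: for a proper homogeneous ideal $J$, a family $\mathcal N=\{\mathcal N_0,\ldots,\mathcal N_s\}$ is a complement of $J$ up to degree $s$ if $\mathcal N_0=\{1\}$ and, for each $k=1,\ldots,s$, $\mathcal N_k\subseteq\mathcal T_k$ is a set of monomials with $\mathcal N_k\subset\mathcal N_{k-1}^+$ and $\mathcal P_k=J_k\oplus\langle\mathcal N_k\rangle$.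 For a finite family $(F_1,\ldots,F_h)$ of polynomials, $\mathrm{Syz}(F_1,\ldots,F_h)=\{(a_1,\ldots,a_h)\in\mathcal P^h : \sum_i a_iF_i=0\}$. *)

theory Defs
  imports
    "HOL-Computational_Algebra.Polynomial"
    "HOL-Library.Poly_Mapping"
    "HOL-Library.Function_Algebras"
begin

text \<open>
  Polynomials over \<open>'k\<close> in the variables \<open>x\<^sub>j\<close>, \<open>j :: 'v\<close>, as finitely supported maps from exponent
  vectors to coefficients. For \<open>'v\<close> of class \<^class>\<open>finite\<close> (types are nonempty) this is
  \<open>\<bbbK>[x\<^sub>0,\<dots>,x\<^sub>n]\<close> with \<open>n + 1 = CARD('v)\<close>, \<open>n \<ge> 0\<close> arbitrary.
\<close>

type_synonym ('v, 'k) mpol = "('v \<Rightarrow>\<^sub>0 nat) \<Rightarrow>\<^sub>0 'k"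

definition var :: "'v \<Rightarrow> ('v, 'k::comm_ring_1) mpol" where
  "var j = Poly_Mapping.single (Poly_Mapping.single j 1) 1"

definition exp_degree :: "('v::finite \<Rightarrow>\<^sub>0 nat) \<Rightarrow> nat" where
  "exp_degree m = (\<Sum>j\<in>UNIV. Poly_Mapping.lookup m j)"

text \<open>The zero polynomial gets degree 0, so ``degree at most d'' includes it.\<close>

definition total_degree :: "('v::finite, 'k::zero) mpol \<Rightarrow> nat" where
  "total_degree p = Max (insert 0 (exp_degree ` Poly_Mapping.keys p))"

definition kscale :: "'k::comm_ring_1 \<Rightarrow> ('v, 'k) mpol \<Rightarrow> ('v, 'k) mpol" where
  "kscale c p = Poly_Mapping.single 0 c * p"

definition vscale :: "'p::comm_ring_1 \<Rightarrow> ('i \<Rightarrow> 'p) \<Rightarrow> ('i \<Rightarrow> 'p)" where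
  "vscale p a = (\<lambda>i. p * a i)"

text \<open>
  \<open>K\<close>: the polynomials as a \<open>\<bbbK>\<close>-vector space. \<open>vec\<close>: vectors of ring elements as a module over
  the ring. For a commutative ring as a module over itself, \<open>module.subspace (*)\<close> is the notion of
  ideal and \<open>module.span (*)\<close> is the ideal generated by a set. That module is not interpreted
  globally: its rule \<open>scale_scale\<close> would become the simp rule \<open>a * (b * x) = (a * b) * x\<close>.
\<close>

global_interpretation K: vector_space "kscale :: 'k::field \<Rightarrow> ('v, 'k) mpol \<Rightarrow> ('v, 'k) mpol"
proof (unfold_locales, goal_cases)
  case (1 a x y)
  show ?case by (simp only: kscale_def distrib_left)
next
  case (2 a b x)
  show ?case by (simp only: kscale_def single_add distrib_right)
next
  case (3 a b x)
  have "Poly_Mapping.single 0 a * Poly_Mapping.single 0 b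
      = (Poly_Mapping.single 0 (a * b) :: ('v, 'k) mpol)"
    by (simp only: mult_single add_0)
  then show ?case by (simp only: kscale_def mult.assoc [symmetric])
next
  case (4 x)
  show ?case by (simp only: kscale_def single_one mult_1)
qed

lemma module_times: "module ((*) :: 'p::comm_ring_1 \<Rightarrow> 'p \<Rightarrow> 'p)"
  by unfold_locales (simp_all add: distrib_left distrib_right mult.assoc)

global_interpretation vec: module "vscale :: 'p::comm_ring_1 \<Rightarrow> ('i \<Rightarrow> 'p) \<Rightarrow> ('i \<Rightarrow> 'p)"
  by unfold_locales (simp_all add: vscale_def fun_eq_iff distrib_left distrib_right mult.assoc)

definition monoms :: "nat \<Rightarrow> ('v::finite, 'k::field) mpol set" where
  "monoms k = {Poly_Mapping.single m 1 | m. exp_degree m = k}"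

definition graded :: "nat \<Rightarrow> ('v::finite, 'k::field) mpol set" where
  "graded k = K.span (monoms k)"

definition homogeneous_ideal :: "('v::finite, 'k::field) mpol set \<Rightarrow> bool" where
  "homogeneous_ideal J \<longleftrightarrow> module.subspace (*) J \<and> (\<exists>G \<subseteq> (\<Union>k. graded k). J = module.span (*) G)"

definition plus_set :: "('v, 'k::comm_ring_1) mpol set \<Rightarrow> ('v, 'k) mpol set" where
  "plus_set S = (\<Union>j. (\<lambda>p. var j * p) ` S)"

definition direct_sum :: "'p::ab_group_add set \<Rightarrow> 'p set \<Rightarrow> 'p set \<Rightarrow> bool" where
  "direct_sum W A B \<longleftrightarrow> W = {a + b | a b. a \<in> A \<and> b \<in> B} \<and> A \<inter> B = {0}"

text \<open>Only the values \<open>N 0, \<dots>, N s\<close> of the family matter.\<close>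

definition complement_upto ::
  "('v::finite, 'k::field) mpol set \<Rightarrow> nat \<Rightarrow> (nat \<Rightarrow> ('v, 'k) mpol set) \<Rightarrow> bool" where
  "complement_upto J s N \<longleftrightarrow>
     N 0 = {1} \<and>
     (\<forall>k\<in>{1..s}. N k \<subseteq> monoms k \<and> N k \<subseteq> plus_set (N (k - 1)) \<and>
        direct_sum (graded k) (J \<inter> graded k) (K.span (N k)))"

definition is_K_basis :: "('v, 'k::field) mpol set \<Rightarrow> ('v, 'k) mpol set \<Rightarrow> bool" where
  "is_K_basis B W \<longleftrightarrow> K.independent B \<and> K.span B = W"

text \<open>
  A vector of length \<open>h\<close> is a function on \<^typ>\<open>nat\<close> vanishing outside \<open>{1..h}\<close>; the family \<open>F\<close> is
  only evaluated on \<open>{1..h}\<close>.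
\<close>

definition syz :: "nat \<Rightarrow> (nat \<Rightarrow> 'p::comm_ring_1) \<Rightarrow> (nat \<Rightarrow> 'p) set" where
  "syz h F = {a. (\<forall>i. i \<notin> {1..h} \<longrightarrow> a i = 0) \<and> (\<Sum>i=1..h. a i * F i) = 0}"

end

theory Submission
  imports Defs "HOL-Library.Multiset"
begin

text \<open>
  Let \<open>B\<close> be the span of \<open>N\<^sub>0 \<union> \<dots> \<union> N\<^sub>s\<close>, and let \<open>I\<close> consist of the polynomials whose homogeneous
  parts of degree at most \<open>s\<close> lie in \<open>J\<close>. Then \<open>I\<close> is an ideal, \<open>\<P> = I \<oplus> B\<close>, and the given family is
  a \<open>\<bbbK>\<close>-basis of \<open>I \<inter> B\<^sup>+\<close>, where \<open>B\<^sup>+ = B + x\<^sub>0B + \<dots> + x\<^sub>nB\<close>: in degree \<open>k \<le> s\<close> the elements of \<open>V\<^sub>k\<close>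
  are what has to be added to \<open>N\<^sub>k\<close> to span \<open>N\<^bsub>k-1\<^esub>\<^sup>+\<close>, and in degree \<open>s + 1\<close> nothing of \<open>B\<close> is left. So the
  family is a border basis of \<open>I\<close>, and the statement is that syzygies of border bases are generated by
  linear ones.

  For \<open>u\<close> in \<open>B\<close> write \<open>x\<^sub>j u = M\<^sub>j u + w\<^sub>j u\<close> with \<open>M\<^sub>j u\<close> in \<open>B\<close> and \<open>w\<^sub>j u\<close> in \<open>I \<inter> B\<^sup>+\<close>, and let \<open>[w]\<close> be the
  vector of the coordinates of \<open>w\<close> in the family, whose entries are constants. Expanding
  \<open>x\<^sub>i x\<^sub>j u = x\<^sub>j x\<^sub>i u\<close> in both orders gives the syzygy
  \<open>x\<^sub>i [w\<^sub>j u] + [w\<^sub>i (M\<^sub>j u)] - x\<^sub>j [w\<^sub>i u] - [w\<^sub>j (M\<^sub>i u)]\<close>, with entries of degree at most \<open>1\<close>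
  (\<open>commutation_syzygy_in_L\<close>).

  Let \<open>L\<close> be the module generated by all syzygies with such entries. Modulo \<open>L\<close> the operators
  \<open>(p, q) \<mapsto> (x\<^sub>j p, x\<^sub>j q + [w\<^sub>j (\<pi> p)])\<close> commute, where \<open>\<pi>\<close> is the projection onto \<open>B\<close>. Hence there is a
  \<open>\<bbbK>\<close>-linear map \<open>D\<close> with \<open>D 1 \<equiv> 0\<close> and \<open>D (x\<^sub>j p) \<equiv> x\<^sub>j D p + [w\<^sub>j (\<pi> p)]\<close> modulo \<open>L\<close>
  (\<open>ex_division\<close>); it records the quotients of a division by the family. Since every monomial in some
  \<open>N\<^sub>k\<close> is reached from \<open>1\<close> inside \<open>B\<close>, \<open>D\<close> vanishes on \<open>B\<close> modulo \<open>L\<close>. One more multiplication shows that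
  on \<open>I \<inter> B\<^sup>+\<close> it agrees with \<open>[ ]\<close>, so it sends the \<open>i\<close>-th member of the family to the \<open>i\<close>-th basis
  vector. As \<open>\<pi>\<close> vanishes on \<open>I\<close>, \<open>D\<close> is \<open>\<P>\<close>-linear on \<open>I\<close> modulo \<open>L\<close>, and therefore
  \<open>D (\<Sum> a\<^sub>i F\<^sub>i) \<equiv> a\<close> for every vector \<open>a\<close>. If \<open>a\<close> is a syzygy, the left side is \<open>0\<close>, so \<open>a\<close> lies in \<open>L\<close>.
\<close>

section \<open>Exponents, monomials and degrees\<close>

abbreviation unit_exp :: "'v \<Rightarrow> ('v \<Rightarrow>\<^sub>0 nat)" where
  "unit_exp j \<equiv> Poly_Mapping.single j 1"

lemma exp_degree_add: "exp_degree (m + n) = exp_degree m + exp_degree n"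
  by (simp add: exp_degree_def lookup_add sum.distrib)

lemma exp_degree_0 [simp]: "exp_degree 0 = 0"
  by (simp add: exp_degree_def)

lemma exp_degree_unit [simp]: "exp_degree (unit_exp j) = 1"
  by (simp add: exp_degree_def lookup_single when_def)

lemma exp_degree_eq_0_iff: "exp_degree m = 0 \<longleftrightarrow> m = 0"
  by (auto simp: exp_degree_def poly_mapping_eq_iff fun_eq_iff)

lemma finite_exp_degree: "finite {m :: 'v::finite \<Rightarrow>\<^sub>0 nat. exp_degree m = k}"
proof (rule finite_imageD)
  have "Poly_Mapping.lookup ` {m :: 'v \<Rightarrow>\<^sub>0 nat. exp_degree m = k}
      \<subseteq> {f. \<forall>j. (j \<in> UNIV \<longrightarrow> f j \<in> {..k}) \<and> (j \<notin> UNIV \<longrightarrow> f j = 0)}"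
    by (auto simp: exp_degree_def intro!: member_le_sum)
  then show "finite (Poly_Mapping.lookup ` {m :: 'v \<Rightarrow>\<^sub>0 nat. exp_degree m = k})"
    by (rule finite_subset) (intro finite_set_of_finite_funs finite finite_atMost)
  show "inj_on Poly_Mapping.lookup {m :: 'v \<Rightarrow>\<^sub>0 nat. exp_degree m = k}"
    by (rule inj_onI) (simp add: Poly_Mapping.lookup_inject)
qed

text \<open>
  A list of variables is a way to build the monomial by successive multiplications; recursion along
  such lists replaces recursion on exponents.
\<close>

lemma ex_list_of_exponent: "\<exists>l. \<forall>j. count_list l j = Poly_Mapping.lookup m j"
proof -
  obtain l where "mset l = Abs_multiset (Poly_Mapping.lookup m)"
    using ex_mset by blast
  then have "count (mset l) = Poly_Mapping.lookup m"
    by (simp add: Abs_multiset_inverse)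
  then show ?thesis by (metis count_mset)
qed

lemma var_times_single: "var j * Poly_Mapping.single m c = Poly_Mapping.single (m + unit_exp j) c"
  by (simp add: var_def mult_single add.commute)

lemma mpol_sum_induct [case_names monomial add]:
  assumes "\<And>m c. P (Poly_Mapping.single m c)"
    and "\<And>p q. P p \<Longrightarrow> P q \<Longrightarrow> P (p + q)"
  shows "P (p :: ('v, 'k::comm_ring_1) mpol)"
proof (induction p rule: update_induct)
  case const
  show ?case using assms(1)[of 0 0] by simp
next
  case (update f a b)
  have "Poly_Mapping.update a b f = f + Poly_Mapping.single a b"
    using update(1)
    by (intro poly_mapping_eqI) (auto simp: lookup_update lookup_add lookup_single in_keys_iff)
  with update assms show ?case by simp
qed

lemma exponent_induct [case_names zero unit]:
  assumes "P 0" and "\<And>m j. P m \<Longrightarrow> P (m + unit_exp j)"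
  shows "P (m :: 'v \<Rightarrow>\<^sub>0 nat)"
proof -
  obtain l where l: "\<And>j. count_list l j = Poly_Mapping.lookup m j"
    using ex_list_of_exponent by metis
  then show ?thesis
  proof (induction l arbitrary: m)
    case Nil
    then have "m = 0" by (auto intro: poly_mapping_eqI)
    with assms(1) show ?case by simp
  next
    case (Cons j l)
    let ?m = "m - unit_exp j"
    have m: "m = ?m + unit_exp j"
    proof (intro poly_mapping_eqI)
      fix i show "Poly_Mapping.lookup m i = Poly_Mapping.lookup (?m + unit_exp j) i"
        using Cons.prems[of j] by (auto simp: lookup_add lookup_minus lookup_single when_def)
    qed
    have "count_list l i = Poly_Mapping.lookup ?m i" for i
      using Cons.prems[of i] by (auto simp: lookup_minus lookup_single when_def split: if_splits)
    then have "P ?m" by (rule Cons.IH)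
    then have "P (?m + unit_exp j)" by (rule assms(2))
    then show ?case using m by simp
  qed
qed

lemma mpol_var_induct [case_names const var add]:
  assumes "\<And>c. P (Poly_Mapping.single 0 c)"
    and "\<And>j p. P p \<Longrightarrow> P (var j * p)"
    and "\<And>p q. P p \<Longrightarrow> P q \<Longrightarrow> P (p + q)"
  shows "P (p :: ('v, 'k::comm_ring_1) mpol)"
proof (induction p rule: mpol_sum_induct)
  case (monomial m c)
  show ?case
  proof (induction m rule: exponent_induct)
    case (unit m j)
    then show ?case using assms(2)[of "Poly_Mapping.single m c" j] by (simp only: var_times_single)
  qed (rule assms(1))
qed (rule assms(3))

lemma total_degree_le_iff:
  "total_degree p \<le> d \<longleftrightarrow> (\<forall>m\<in>Poly_Mapping.keys p. exp_degree m \<le> d)"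
  by (auto simp: total_degree_def)

lemma total_degree_add_le:
  assumes "total_degree p \<le> d" "total_degree q \<le> d"
  shows "total_degree (p + q :: ('v::finite, 'k::comm_ring_1) mpol) \<le> d"
  using assms keys_add[of p q] unfolding total_degree_le_iff by blast

lemma total_degree_uminus: "total_degree (- p :: ('v::finite, 'k::comm_ring_1) mpol) = total_degree p"
proof -
  have "Poly_Mapping.keys (- p) = Poly_Mapping.keys p" by (auto simp: in_keys_iff)
  then show ?thesis by (simp add: total_degree_def)
qed

lemma total_degree_diff_le:
  assumes "total_degree p \<le> d" "total_degree q \<le> d"
  shows "total_degree (p - q :: ('v::finite, 'k::comm_ring_1) mpol) \<le> d"
  using total_degree_add_le[of p d "- q"] assms by (simp add: total_degree_uminus)

lemma total_degree_single_le: "total_degree (Poly_Mapping.single m c) \<le> exp_degree m"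
  by (simp add: total_degree_le_iff)

lemma kscale_mult_right: "p * kscale c q = kscale c (p * q)"
  by (simp add: kscale_def mult.left_commute)

lemma var_mult_span:
  assumes "p \<in> K.span S"
  shows "var j * p \<in> K.span (plus_set (S :: ('v, 'k::field) mpol set))"
  using assms
proof (induction rule: K.span_induct_alt)
  case base
  show ?case by (simp add: K.span_zero)
next
  case (step c x y)
  have "var j * x \<in> K.span (plus_set S)"
    using step(1) by (auto simp: plus_set_def intro!: K.span_base)
  with step(2) show ?case
    by (simp add: distrib_left kscale_mult_right K.span_add K.span_scale)
qed

section \<open>Iterating operators that commute up to an equivalence\<close>

text \<open>
  Moving one operator past the others needs only the commutation of neighbours, up to \<open>R\<close>, and that
  the operators already applied respect \<open>R\<close>.
\<close>

lemma foldr_permute_rel: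
  assumes R: "equivp R"
    and resp: "\<And>j a b. R a b \<Longrightarrow> R (X j a) (X j b)"
    and comm: "\<And>i j a. R (X i (X j a)) (X j (X i a))"
  shows "mset l = mset l' \<Longrightarrow> R (foldr X l a) (foldr X l' a)"
proof (induction l arbitrary: l')
  case Nil
  then show ?case using R by (simp add: equivp_reflp)
next
  case (Cons j l)
  have front: "R (foldr X (u @ j # v) a) (X j (foldr X (u @ v) a))" for u v
  proof (induction u)
    case Nil
    show ?case using R by (simp add: equivp_reflp)
  next
    case (Cons i u)
    show ?case using equivp_transp[OF R resp[OF Cons] comm] by simp
  qed
  have "j \<in> set l'" using Cons.prems by (metis list.set_intros(1) set_mset_mset)
  then obtain u v where l': "l' = u @ j # v" by (meson split_list)
  have "mset l = mset (u @ v)" using Cons.prems l' by simp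
  then have "R (X j (foldr X l a)) (X j (foldr X (u @ v) a))" by (intro resp Cons.IH)
  from equivp_transp[OF R this equivp_symp[OF R front]] show ?case by (simp add: l')
qed

text \<open>
  A recursion on monomials that multiplies by one variable at a time. Its value depends on the order
  in which the variables are taken only up to \<open>R\<close>, so any choice of orders gives a solution up to \<open>R\<close>.
\<close>

lemma monomial_recursion:
  fixes X :: "'v \<Rightarrow> 'a \<Rightarrow> 'a" and a :: 'a
  assumes R: "equivp R"
    and resp: "\<And>j a b. R a b \<Longrightarrow> R (X j a) (X j b)"
    and comm: "\<And>i j a. R (X i (X j a)) (X j (X i a))"
  obtains T :: "('v \<Rightarrow>\<^sub>0 nat) \<Rightarrow> 'a"
    where "R (T 0) a" and "\<And>m j. R (T (m + unit_exp j)) (X j (T m))"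
proof -
  define L where "L m = (SOME l. \<forall>j. count_list l j = Poly_Mapping.lookup m j)"
    for m :: "'v \<Rightarrow>\<^sub>0 nat"
  have L: "count_list (L m) j = Poly_Mapping.lookup m j" for m j
    using someI_ex[OF ex_list_of_exponent[of m]] by (simp add: L_def)
  have perm: "R (foldr X (L m) a) (foldr X l a)"
    if "\<And>j. count_list l j = Poly_Mapping.lookup m j" for m l
    by (rule foldr_permute_rel[where R = R and X = X])
      (simp_all add: R resp comm multiset_eq_iff count_mset L that)
  show thesis
  proof (rule that[of "\<lambda>m. foldr X (L m) a"])
    show "R (foldr X (L 0) a) a" using perm[of "[]" 0] by simp
    show "R (foldr X (L (m + unit_exp j)) a) (X j (foldr X (L m) a))" for m j
      using perm[of "j # L m" "m + unit_exp j"]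
      by (simp add: L lookup_add lookup_single when_def)
  qed
qed

section \<open>Syzygies of a border basis\<close>

inductive_set connected_to_one :: "('v, 'k::comm_ring_1) mpol set \<Rightarrow> ('v, 'k) mpol set"
  for N where
  one: "1 \<in> N \<Longrightarrow> 1 \<in> connected_to_one N"
| step: "n \<in> connected_to_one N \<Longrightarrow> var j * n \<in> N \<Longrightarrow> var j * n \<in> connected_to_one N"

text \<open>
  \<open>E\<close> spans all elements of \<open>I\<close> that lie at most one multiplication by a variable away from the span of
  \<open>N\<close>; this is more than generating \<open>I\<close> as an ideal, and it is what makes the part of such a product that
  lies in \<open>I\<close> a combination of \<open>E\<close> with constant coefficients.
\<close>

locale border_basis =
  fixes I N E :: "('v::finite, 'k::field) mpol set" and h :: nat and F :: "nat \<Rightarrow> ('v, 'k) mpol"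
  assumes ideal: "module.subspace (*) I"
    and complement: "direct_sum UNIV I (K.span N)"
    and connected: "N \<subseteq> connected_to_one N"
    and indep: "K.independent E"
    and span_E: "K.span E = I \<inter> K.span (N \<union> plus_set N)"
    and enum: "bij_betw F {1..h} E"
begin

lemma I_simps: "0 \<in> I" "p \<in> I \<Longrightarrow> q \<in> I \<Longrightarrow> p + q \<in> I" "p \<in> I \<Longrightarrow> r * p \<in> I"
    "p \<in> I \<Longrightarrow> q \<in> I \<Longrightarrow> p - q \<in> I" "p \<in> I \<Longrightarrow> kscale c p \<in> I"
proof -
  interpret P: module "(*) :: ('v, 'k) mpol \<Rightarrow> _" by (rule module_times)
  show "0 \<in> I" "p \<in> I \<Longrightarrow> q \<in> I \<Longrightarrow> p + q \<in> I" "p \<in> I \<Longrightarrow> r * p \<in> I"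
    "p \<in> I \<Longrightarrow> q \<in> I \<Longrightarrow> p - q \<in> I" "p \<in> I \<Longrightarrow> kscale c p \<in> I"
    using ideal by (auto simp: kscale_def intro: P.subspace_0 P.subspace_add P.subspace_scale P.subspace_diff)
qed

text \<open>
  The projection onto the span of \<open>N\<close> along \<open>I\<close>, the normal form modulo \<open>I\<close>.
\<close>

definition nf :: "('v, 'k) mpol \<Rightarrow> ('v, 'k) mpol" where
  "nf p = (THE b. b \<in> K.span N \<and> p - b \<in> I)"

lemma nf_eqI:
  assumes "b \<in> K.span N" "p - b \<in> I"
  shows "nf p = b"
  unfolding nf_def
proof (rule the_equality)
  fix b' assume b': "b' \<in> K.span N \<and> p - b' \<in> I"
  have "b' - b \<in> K.span N" using assms b' by (simp add: K.span_diff)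
  moreover have "b' - b \<in> I" using I_simps(4)[OF assms(2), of "p - b'"] b' by simp
  ultimately have "b' - b \<in> I \<inter> K.span N" by simp
  moreover have "I \<inter> K.span N = {0}" using complement by (simp add: direct_sum_def)
  ultimately have "b' - b \<in> {0}" by simp
  then show "b' = b" by simp
qed (use assms in simp)

lemma nf: "nf p \<in> K.span N" "p - nf p \<in> I"
proof -
  have "p \<in> {a + b |a b. a \<in> I \<and> b \<in> K.span N}" using complement by (simp add: direct_sum_def)
  then obtain a b where "p = a + b" "a \<in> I" "b \<in> K.span N" by auto
  then have "b \<in> K.span N \<and> p - b \<in> I" by simp
  with nf_eqI show "nf p \<in> K.span N" "p - nf p \<in> I" by auto
qed

lemma nf_add: "nf (p + q) = nf p + nf q"
  using I_simps(2)[OF nf(2)[of p] nf(2)[of q]]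
  by (intro nf_eqI) (simp_all add: nf K.span_add add_diff_add)

lemma nf_scale: "nf (kscale c p) = kscale c (nf p)"
  using I_simps(5)[OF nf(2)[of p], of c]
  by (intro nf_eqI) (simp_all add: nf K.span_scale K.scale_right_diff_distrib)

lemma nf_id: "p \<in> K.span N \<Longrightarrow> nf p = p"
  by (intro nf_eqI) (simp_all add: I_simps)

lemma nf_0_if_in_I: "p \<in> I \<Longrightarrow> nf p = 0"
  by (intro nf_eqI) (simp_all add: K.span_zero)

text \<open>
  Normal forms carry the multiplication of the quotient by \<open>I\<close>; this is why the multiplication
  operators on the span of \<open>N\<close> commute.
\<close>

lemma nf_var_nf: "nf (var j * nf p) = nf (var j * p)"
proof (rule nf_eqI)
  have "var j * nf p - nf (var j * p) = (var j * p - nf (var j * p)) - var j * (p - nf p)"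
    by (simp add: algebra_simps)
  then show "var j * nf p - nf (var j * p) \<in> I" by (simp only: I_simps nf)
qed (simp add: nf)

text \<open>
  For \<open>u\<close> in the span of \<open>N\<close> this is the part \<open>w\<^sub>j u\<close> of \<open>x\<^sub>j u\<close> that lies in \<open>I\<close>. Composing with the
  normal form extends it to all polynomials, by zero on \<open>I\<close>.
\<close>

definition border_part :: "'v \<Rightarrow> ('v, 'k) mpol \<Rightarrow> ('v, 'k) mpol" where
  "border_part j p = var j * nf p - nf (var j * p)"

lemma border_part_in_span: "border_part j p \<in> K.span E"
proof -
  have "border_part j p \<in> I"
    using nf(2)[of "var j * nf p"] by (simp add: border_part_def nf_var_nf)
  moreover have "var j * nf p \<in> K.span (N \<union> plus_set N)" "nf (var j * p) \<in> K.span (N \<union> plus_set N)"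
    using var_mult_span[OF nf(1), of j p] nf(1)[of "var j * p"]
      K.span_mono[of N "N \<union> plus_set N"] K.span_mono[of "plus_set N" "N \<union> plus_set N"] by auto
  ultimately show ?thesis by (simp add: span_E border_part_def K.span_diff)
qed

lemma border_part_add: "border_part j (p + q) = border_part j p + border_part j q"
  by (simp add: border_part_def distrib_left nf_add)

lemma border_part_scale: "border_part j (kscale c p) = kscale c (border_part j p)"
  by (simp add: border_part_def kscale_mult_right nf_scale K.scale_right_diff_distrib)

definition coords :: "('v, 'k) mpol \<Rightarrow> nat \<Rightarrow> ('v, 'k) mpol" where
  "coords w = (\<lambda>i. if i \<in> {1..h} then Poly_Mapping.single 0 (K.representation E w (F i)) else 0)"

definition eval_family :: "(nat \<Rightarrow> ('v, 'k) mpol) \<Rightarrow> ('v, 'k) mpol" where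
  "eval_family a = (\<Sum>i=1..h. a i * F i)"

lemma eval_family_add: "eval_family (a + b) = eval_family a + eval_family b"
  by (simp add: eval_family_def distrib_right sum.distrib)

lemma eval_family_diff: "eval_family (a - b) = eval_family a - eval_family b"
  by (simp add: eval_family_def left_diff_distrib sum_subtractf)

lemma eval_family_vscale: "eval_family (vscale p a) = p * eval_family a"
  by (simp add: eval_family_def vscale_def sum_distrib_left mult.assoc)

lemma eval_family_coords:
  assumes "w \<in> K.span E"
  shows "eval_family (coords w) = w"
proof -
  have "eval_family (coords w) = (\<Sum>i=1..h. kscale (K.representation E w (F i)) (F i))"
    by (simp add: eval_family_def coords_def kscale_def)
  also have "\<dots> = (\<Sum>e\<in>E. kscale (K.representation E w e) e)"
    by (rule sum.reindex_bij_betw[OF enum])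
  also have "\<dots> = w"
    using enum by (intro K.sum_representation_eq indep assms) (auto simp: bij_betw_finite[symmetric])
  finally show ?thesis .
qed

lemma coords_add: "w \<in> K.span E \<Longrightarrow> w' \<in> K.span E \<Longrightarrow> coords (w + w') = coords w + coords w'"
  by (auto simp: coords_def fun_eq_iff K.representation_add indep single_add)

lemma coords_scale:
  "w \<in> K.span E \<Longrightarrow> coords (kscale c w) = vscale (Poly_Mapping.single 0 c) (coords w)"
  by (auto simp: coords_def fun_eq_iff vscale_def K.representation_scale indep mult_single)

lemma coords_0: "coords 0 = 0"
  by (simp add: coords_def fun_eq_iff K.representation_zero)

definition basis_vec :: "nat \<Rightarrow> nat \<Rightarrow> ('v, 'k) mpol" where
  "basis_vec i = (\<lambda>k. if k = i then 1 else 0)"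

lemma coords_F: "i \<in> {1..h} \<Longrightarrow> coords (F i) = basis_vec i"
proof -
  assume i: "i \<in> {1..h}"
  then have "F i \<in> E" using enum bij_betwE by blast
  moreover have "F k = F i \<longleftrightarrow> k = i" if "k \<in> {1..h}" for k
    using that i enum by (auto simp: bij_betw_def dest: inj_on_eq_iff)
  ultimately have "coords (F i) k = basis_vec i k" for k
    using i by (cases "k \<in> {1..h}") (auto simp: coords_def basis_vec_def K.representation_basis[OF indep])
  then show ?thesis by blast
qed

definition linear_syz :: "(nat \<Rightarrow> ('v, 'k) mpol) set" where
  "linear_syz = {g \<in> syz h F. \<forall>i\<in>{1..h}. total_degree (g i) \<le> 1}"

definition L :: "(nat \<Rightarrow> ('v, 'k) mpol) set" where
  "L = vec.span linear_syz"

lemma L_simps: "0 \<in> L" "a \<in> L \<Longrightarrow> b \<in> L \<Longrightarrow> a + b \<in> L" "a \<in> L \<Longrightarrow> b \<in> L \<Longrightarrow> a - b \<in> L"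
    "a \<in> L \<Longrightarrow> vscale p a \<in> L" "a \<in> L \<Longrightarrow> - a \<in> L"
  by (simp_all add: L_def vec.span_zero vec.span_add vec.span_diff vec.span_scale vec.span_neg)

text \<open>
  The two ways of dividing \<open>x\<^sub>i x\<^sub>j p\<close> by \<open>E\<close>, starting from the normal form of \<open>p\<close>, compared.
\<close>

definition commutation_syzygy :: "'v \<Rightarrow> 'v \<Rightarrow> ('v, 'k) mpol \<Rightarrow> nat \<Rightarrow> ('v, 'k) mpol" where
  "commutation_syzygy i j p =
     (vscale (var i) (coords (border_part j p)) + coords (border_part i (var j * p)))
   - (vscale (var j) (coords (border_part i p)) + coords (border_part j (var i * p)))"

text \<open>
  Evaluated on the family, both halves give the same polynomial, \<open>x\<^sub>i x\<^sub>j u\<close> minus its normal form, for \<open>u\<close> the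
  normal form of \<open>p\<close>; the only non-constant factors in the entries are the two variables.
\<close>

lemma commutation_syzygy_in_L: "commutation_syzygy i j p \<in> L"
proof -
  have "eval_family (commutation_syzygy i j p) = 0"
    by (simp add: commutation_syzygy_def eval_family_add eval_family_diff eval_family_vscale
        eval_family_coords border_part_in_span)
      (simp add: border_part_def algebra_simps)
  moreover have "total_degree (coords w k) \<le> 1" for w k
    using total_degree_single_le[of 0 "K.representation E w (F k)"]
    by (auto simp: coords_def total_degree_def)
  moreover have "total_degree (var j * coords w k) \<le> 1" for w k j
    using total_degree_single_le[of "unit_exp j" "K.representation E w (F k)"]
    by (auto simp: coords_def var_times_single total_degree_def simp del: One_nat_def)
  ultimately have "commutation_syzygy i j p \<in> linear_syz"
    by (auto simp: linear_syz_def syz_def eval_family_def commutation_syzygy_def vscale_def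
        intro!: total_degree_add_le total_degree_diff_le) (auto simp: coords_def)
  then show ?thesis by (simp add: L_def vec.span_base)
qed

text \<open>
  \<open>D p\<close> collects the quotients when \<open>p\<close> is divided by \<open>E\<close> one variable at a time. They depend on the order
  of the variables, but only modulo \<open>L\<close>, because interchanging two steps changes them by a multiple of a
  commutation syzygy.
\<close>

lemma ex_division:
  obtains D :: "('v, 'k) mpol \<Rightarrow> nat \<Rightarrow> ('v, 'k) mpol"
  where "D 1 \<in> L"
    and "\<And>p q. D (p + q) = D p + D q"
    and "\<And>c p. D (kscale c p) = vscale (Poly_Mapping.single 0 c) (D p)"
    and "\<And>j p. D (var j * p) - (vscale (var j) (D p) + coords (border_part j p)) \<in> L"
proof -
  define R where "R = (\<lambda>x y :: ('v, 'k) mpol \<times> (nat \<Rightarrow> ('v, 'k) mpol). fst x = fst y \<and> snd x - snd y \<in> L)"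
  define X where "X = (\<lambda>j (x :: ('v, 'k) mpol \<times> (nat \<Rightarrow> ('v, 'k) mpol)).
    (var j * fst x, vscale (var j) (snd x) + coords (border_part j (fst x))))"
  \<comment> \<open>The first component only remembers the monomial reached so far, on which the next step depends.\<close>
  have R: "equivp R"
  proof (rule equivpI)
    show "reflp R" by (simp add: R_def reflp_def L_simps)
    show "symp R" by (auto simp: R_def symp_def dest: L_simps(5))
    show "transp R" by (auto simp: R_def transp_def dest: L_simps(2))
  qed
  have resp: "R (X j x) (X j y)" if "R x y" for j x y
    using that L_simps(4)[of "snd x - snd y" "var j"]
    by (auto simp: R_def X_def vec.scale_right_diff_distrib)
  have comm: "R (X i (X j x)) (X j (X i x))" for i j x
  proof -
    have "vscale (var i) (vscale (var j) (snd x)) = vscale (var j) (vscale (var i) (snd x))"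
      by (simp add: vscale_def fun_eq_iff mult.left_commute)
    then have "snd (X i (X j x)) - snd (X j (X i x)) = commutation_syzygy i j (fst x)"
      by (simp add: X_def commutation_syzygy_def vec.scale_right_distrib)
    then show ?thesis using commutation_syzygy_in_L[of i j "fst x"]
      by (simp add: R_def) (simp add: X_def mult.left_commute)
  qed
  obtain T where T0: "R (T 0) (1, 0)" and T: "\<And>m j. R (T (m + unit_exp j)) (X j (T m))"
    using monomial_recursion[where R = R and X = X and a = "(1, 0)", OF R resp comm] by blast
  have fst_T: "fst (T m) = Poly_Mapping.single m 1" for m
    by (induction m rule: exponent_induct)
      (use T0 T in \<open>simp_all add: R_def X_def var_times_single del: One_nat_def\<close>)
  define D where "D p = (\<Sum>m\<in>Poly_Mapping.keys p.
    vscale (Poly_Mapping.single 0 (Poly_Mapping.lookup p m)) (snd (T m)))" for p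
  have D_superset: "D p = (\<Sum>m\<in>A. vscale (Poly_Mapping.single 0 (Poly_Mapping.lookup p m)) (snd (T m)))"
    if "finite A" "Poly_Mapping.keys p \<subseteq> A" for p A
    unfolding D_def using that by (intro sum.mono_neutral_left) (auto simp: in_keys_iff)
  have D_add: "D (p + q) = D p + D q" for p q
  proof -
    let ?A = "Poly_Mapping.keys p \<union> Poly_Mapping.keys q"
    have "D (p + q) = (\<Sum>m\<in>?A. vscale (Poly_Mapping.single 0 (Poly_Mapping.lookup (p + q) m)) (snd (T m)))"
      using keys_add[of p q] by (intro D_superset) auto
    also have "\<dots> = D p + D q"
      by (simp add: D_superset[of ?A p] D_superset[of ?A q] lookup_add single_add
          vec.scale_left_distrib sum.distrib)
    finally show ?thesis .
  qed
  have D_single: "D (Poly_Mapping.single m c) = vscale (Poly_Mapping.single 0 c) (snd (T m))" for m c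
    by (subst D_superset[of "{m}"]) auto
  have D_scale: "D (kscale c p) = vscale (Poly_Mapping.single 0 c) (D p)" for c p
  proof (induction p rule: mpol_sum_induct)
    case (monomial m d)
    show ?case by (simp add: D_single kscale_def mult_single)
  next
    case (add p q)
    then show ?case by (simp only: K.scale_right_distrib D_add vec.scale_right_distrib)
  qed
  show thesis
  proof (rule that[of D])
    show "D 1 \<in> L" using T0 D_single[of 0 1] by (simp add: R_def)
    show "D (var j * p) - (vscale (var j) (D p) + coords (border_part j p)) \<in> L" for j p
    proof (induction p rule: mpol_sum_induct)
      case (monomial m c)
      let ?x = "Poly_Mapping.single m 1 :: ('v, 'k) mpol"
      have x: "Poly_Mapping.single m c = kscale c ?x" by (simp add: kscale_def mult_single)
      have "D (var j * ?x) - (vscale (var j) (D ?x) + coords (border_part j ?x)) \<in> L"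
        using T[of m j] by (simp add: R_def X_def fst_T D_single var_times_single del: One_nat_def)
      then have "vscale (Poly_Mapping.single 0 c)
          (D (var j * ?x) - (vscale (var j) (D ?x) + coords (border_part j ?x))) \<in> L"
        by (rule L_simps)
      moreover have "vscale (Poly_Mapping.single 0 c) (vscale (var j) (D ?x))
          = vscale (var j) (vscale (Poly_Mapping.single 0 c) (D ?x))"
        by (simp add: mult.commute)
      ultimately show ?case
        by (simp only: x kscale_mult_right D_scale border_part_scale coords_scale[OF border_part_in_span]
            vec.scale_right_diff_distrib vec.scale_right_distrib)
    next
      case (add p q)
      have "a + b - (c + d + (e + f)) = a - (c + e) + (b - (d + f))"
        for a b c d e f :: "nat \<Rightarrow> ('v, 'k) mpol"
        by (simp add: fun_eq_iff algebra_simps)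
      with L_simps(2)[OF add] show ?case
        by (simp only: distrib_left D_add border_part_add coords_add[OF border_part_in_span border_part_in_span]
            vec.scale_right_distrib)
    qed
  qed (rule D_add, rule D_scale)
qed

text \<open>
  The division map inverts evaluation modulo \<open>L\<close>, which makes the kernel of evaluation a part of \<open>L\<close>.
\<close>

lemma syz_subset_span_linear: "syz h F \<subseteq> L"
proof
  fix f assume f: "f \<in> syz h F"
  obtain D where D_1: "D 1 \<in> L"
    and D_add: "\<And>p q. D (p + q) = D p + D q"
    and D_scale: "\<And>c p. D (kscale c p) = vscale (Poly_Mapping.single 0 c) (D p)"
    and D_var: "\<And>j p. D (var j * p) - (vscale (var j) (D p) + coords (border_part j p)) \<in> L"
    using ex_division by blast
  have D_0: "D 0 = 0" using D_add[of 0 0] by simp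
  \<comment> \<open>A step from one element of \<open>N\<close> to another stays in normal form and has no border part.\<close>
  have D_conn: "D n \<in> L" if "n \<in> connected_to_one N" for n
    using that
  proof induction
    case (step n j)
    have "n \<in> N" using step(1) by (cases) auto
    then have "border_part j n = 0"
      using step(2) by (simp add: border_part_def nf_id K.span_base)
    then have "D (var j * n) - vscale (var j) (D n) \<in> L"
      using D_var[of j n] by (simp add: coords_0)
    from L_simps(2)[OF this L_simps(4)[OF step(3), of "var j"]] show ?case by simp
  qed (rule D_1)
  \<comment> \<open>One step beyond the span of \<open>N\<close> the quotients are constants; on the span of \<open>E\<close> they are the coordinates.\<close>
  have D_near: "D b - coords (b - nf b) \<in> L \<and> b - nf b \<in> K.span E"
    if "b \<in> K.span (N \<union> plus_set N)" for b
    using that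
  proof (induction rule: K.span_induct_alt)
    case base
    have "nf 0 = 0" by (simp add: nf_id K.span_zero)
    then show ?case by (simp only: D_0 coords_0 diff_self L_simps K.span_zero simp_thms)
  next
    case (step c x y)
    have x: "D x - coords (x - nf x) \<in> L \<and> x - nf x \<in> K.span E"
    proof (cases "x \<in> N")
      case True
      then show ?thesis
        using D_conn connected by (auto simp: nf_id K.span_base K.span_zero coords_0)
    next
      case False
      then obtain j n where n: "n \<in> N" "x = var j * n" using step(1) by (auto simp: plus_set_def)
      then have bp: "border_part j n = x - nf x" by (simp add: border_part_def nf_id K.span_base)
      have "D n \<in> L" using D_conn connected n by auto
      from L_simps(2)[OF D_var[of j n] L_simps(4)[OF this, of "var j"]]
      show ?thesis using border_part_in_span[of j n] by (simp add: n(2) bp)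
    qed
    then have "vscale (Poly_Mapping.single 0 c) (D x - coords (x - nf x)) \<in> L"
      by (blast intro: L_simps)
    then have "vscale (Poly_Mapping.single 0 c) (D x - coords (x - nf x)) + (D y - coords (y - nf y)) \<in> L"
      using step(2) by (blast intro: L_simps)
    moreover have "kscale c x + y - nf (kscale c x + y) = kscale c (x - nf x) + (y - nf y)"
      by (simp add: nf_add nf_scale add_diff_add K.scale_right_diff_distrib)
    moreover have "kscale c (x - nf x) \<in> K.span E" using x by (simp add: K.span_scale)
    ultimately show ?case
      using x step(2)
      by (simp only: D_add D_scale coords_add coords_scale add_diff_add K.span_add
          vec.scale_right_diff_distrib simp_thms)
  qed
  \<comment> \<open>All multiples of \<open>F i\<close> have normal form zero, so no border parts arise on the way from \<open>F i\<close> to \<open>p * F i\<close>.\<close>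
  have D_mult: "D (p * F i) - vscale p (basis_vec i) \<in> L" if i: "i \<in> {1..h}" for p i
  proof (induction p rule: mpol_var_induct)
    case (const c)
    have "F i \<in> K.span E" using i enum bij_betwE K.span_base by blast
    then have "F i \<in> I" "F i \<in> K.span (N \<union> plus_set N)" by (simp_all add: span_E)
    then have "D (F i) - basis_vec i \<in> L"
      using D_near[of "F i"] by (simp add: nf_0_if_in_I coords_F[OF i])
    from L_simps(4)[OF this, of "Poly_Mapping.single 0 c"] show ?case
      using D_scale[of c "F i"] by (simp only: vec.scale_right_diff_distrib kscale_def)
  next
    case (var j p)
    have "F i \<in> K.span E" using i enum bij_betwE K.span_base by blast
    then have "F i \<in> I" by (simp add: span_E)
    then have "border_part j (p * F i) = 0"
      by (simp add: border_part_def nf_0_if_in_I I_simps)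
    then have "D (var j * (p * F i)) - vscale (var j) (D (p * F i)) \<in> L"
      using D_var[of j "p * F i"] by (simp add: coords_0)
    from L_simps(2)[OF this L_simps(4)[OF var, of "var j"]] show ?case
      by (simp only: vec.scale_right_diff_distrib vec.scale_scale mult.assoc add_diff_eq diff_add_cancel)
  next
    case (add p q)
    from L_simps(2)[OF this] show ?case
      by (simp only: distrib_right D_add vec.scale_left_distrib add_diff_add)
  qed
  have D_sum: "D (\<Sum>i\<in>A. g i) = (\<Sum>i\<in>A. D (g i))" for A :: "nat set" and g
    by (induction A rule: infinite_finite_induct) (simp_all add: D_0 D_add)
  have "D (eval_family f) - (\<Sum>i=1..h. vscale (f i) (basis_vec i)) \<in> L"
    unfolding eval_family_def D_sum sum_subtractf[symmetric]
    unfolding L_def by (rule vec.span_sum) (use D_mult L_def in auto)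
  moreover have "(\<Sum>i=1..h. vscale (f i) (basis_vec i)) = f"
  proof
    fix k
    have sum_apply: "(\<Sum>i\<in>A. g i) k = (\<Sum>i\<in>A. g i k)" for A :: "nat set" and g :: "nat \<Rightarrow> nat \<Rightarrow> ('v, 'k) mpol"
      by (induction A rule: infinite_finite_induct) simp_all
    have "(\<Sum>i=1..h. vscale (f i) (basis_vec i)) k = (\<Sum>i=1..h. if k = i then f i else 0)"
      by (simp add: sum_apply vscale_def basis_vec_def if_distrib cong: if_cong)
    also have "\<dots> = f k" using f by (simp add: syz_def)
    finally show "(\<Sum>i=1..h. vscale (f i) (basis_vec i)) k = f k" .
  qed
  moreover have "eval_family f = 0" using f by (simp add: syz_def eval_family_def)
  ultimately have "- f \<in> L" using D_0 by simp
  then show "f \<in> L" using L_simps(5) by fastforce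
qed

lemma span_linear_syz: "vec.span linear_syz = syz h F"
proof
  have "vec.subspace (syz h F)"
    by (rule vec.subspaceI)
      (auto simp: syz_def vscale_def distrib_right sum.distrib mult.assoc simp flip: sum_distrib_left)
  then show "vec.span linear_syz \<subseteq> syz h F"
    by (intro vec.span_minimal) (auto simp: linear_syz_def)
  show "syz h F \<subseteq> vec.span linear_syz"
    using syz_subset_span_linear by (simp add: L_def)
qed

end

section \<open>Homogeneous parts\<close>

definition hom_part :: "nat \<Rightarrow> ('v::finite, 'k::field) mpol \<Rightarrow> ('v, 'k) mpol" where
  "hom_part k p = Poly_Mapping.mapp (\<lambda>m c. c when exp_degree m = k) p"

lemma lookup_hom_part:
  "Poly_Mapping.lookup (hom_part k p) m = (Poly_Mapping.lookup p m when exp_degree m = k)"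
  by (auto simp: hom_part_def lookup_mapp when_def in_keys_iff)

lemma lookup_kscale: "Poly_Mapping.lookup (kscale c p) m = c * Poly_Mapping.lookup p m"
  by (simp add: kscale_def mult_map_scale_conv_mult[symmetric] Poly_Mapping.map.rep_eq when_def)

lemma hom_part_0 [simp]: "hom_part k 0 = 0"
  by (rule poly_mapping_eqI) (simp add: lookup_hom_part)

lemma hom_part_add: "hom_part k (p + q) = hom_part k p + hom_part k q"
  by (rule poly_mapping_eqI) (simp add: lookup_hom_part lookup_add when_def)

lemma hom_part_kscale: "hom_part k (kscale c p) = kscale c (hom_part k p)"
  by (rule poly_mapping_eqI) (simp add: lookup_hom_part lookup_kscale when_def)

lemma hom_part_sum: "hom_part k (\<Sum>i\<in>A. g i) = (\<Sum>i\<in>A. hom_part k (g i))"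
  by (induction A rule: infinite_finite_induct) (simp_all add: hom_part_add)

lemma hom_part_single:
  "hom_part k (Poly_Mapping.single m c) = (if exp_degree m = k then Poly_Mapping.single m c else 0)"
  by (rule poly_mapping_eqI) (auto simp: lookup_hom_part lookup_single when_def)

lemma hom_part_var_Suc: "hom_part (Suc k) (var j * p) = var j * hom_part k p"
proof (induction p rule: mpol_sum_induct)
  case (monomial m c)
  show ?case using exp_degree_unit[of j]
    by (simp add: var_times_single hom_part_single exp_degree_add del: One_nat_def exp_degree_unit)
qed (simp add: distrib_left hom_part_add)

lemma hom_part_var_0: "hom_part 0 (var j * p) = 0"
proof (induction p rule: mpol_sum_induct)
  case (monomial m c)
  show ?case using exp_degree_unit[of j]
    by (simp add: var_times_single hom_part_single exp_degree_add del: One_nat_def exp_degree_unit)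
qed (simp add: distrib_left hom_part_add)

lemma hom_part_graded: "p \<in> graded k \<Longrightarrow> hom_part l p = (if l = k then p else 0)"
  unfolding graded_def
proof (induction rule: K.span_induct_alt)
  case (step c x y)
  then show ?case by (auto simp: monoms_def hom_part_add hom_part_kscale hom_part_single)
qed simp

lemma eq_0_if_hom_parts_0:
  assumes "\<And>k. hom_part k p = 0"
  shows "p = 0"
proof (rule poly_mapping_eqI)
  fix m show "Poly_Mapping.lookup p m = Poly_Mapping.lookup 0 m"
    using lookup_hom_part[of "exp_degree m" p m] assms by simp
qed

lemma plus_set_monoms:
  assumes "S \<subseteq> monoms k"
  shows "plus_set S \<subseteq> monoms (Suc k)"
proof
  fix x assume "x \<in> plus_set S"
  then obtain j n where "x = var j * n" "n \<in> monoms k" using assms by (auto simp: plus_set_def)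
  then obtain m where "x = Poly_Mapping.single (m + unit_exp j) 1" "exp_degree m = k"
    by (auto simp: monoms_def var_times_single)
  moreover from this have "exp_degree (m + unit_exp j) = Suc k"
    by (simp only: exp_degree_add exp_degree_unit)
  ultimately show "x \<in> monoms (Suc k)" unfolding monoms_def by blast
qed

lemma var_mult_graded: "p \<in> graded k \<Longrightarrow> var j * p \<in> graded (Suc k)"
  using var_mult_span[of p "monoms k" j] K.span_mono[OF plus_set_monoms[OF subset_refl]]
  unfolding graded_def by blast

lemma independent_monomials:
  "K.independent {Poly_Mapping.single m 1 :: ('v, 'k::field) mpol | m. True}"
  unfolding K.independent_explicit_module
proof clarify
  fix t :: "('v, 'k) mpol set" and u w
  assume t: "finite t" "t \<subseteq> {Poly_Mapping.single m 1 | m. True}"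
    and 0: "(\<Sum>v\<in>t. kscale (u v) v) = 0" and w: "w \<in> t"
  then obtain m where m: "w = Poly_Mapping.single m 1" by auto
  have "0 = Poly_Mapping.lookup (\<Sum>v\<in>t. kscale (u v) v) m" by (simp add: 0)
  also have "\<dots> = (\<Sum>v\<in>t. if v = Poly_Mapping.single m 1 then u v else 0)"
    unfolding lookup_sum lookup_kscale
  proof (intro sum.cong refl)
    fix v assume "v \<in> t"
    then obtain m' where v: "v = Poly_Mapping.single m' 1" using t(2) by auto
    have "m' = m" if "v = Poly_Mapping.single m 1"
      using arg_cong[OF that, of Poly_Mapping.keys] by (simp add: v)
    then have "v = Poly_Mapping.single m 1 \<longleftrightarrow> m' = m" using v by blast
    then show "u v * Poly_Mapping.lookup v m = (if v = Poly_Mapping.single m 1 then u v else 0)"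
      by (auto simp: v lookup_single when_def)
  qed
  also have "\<dots> = u (Poly_Mapping.single m 1)" using t m w by simp
  finally show "u w = 0" by (simp add: m)
qed

text \<open>
  Taking homogeneous parts separates the members of a relation by degree.
\<close>

lemma independent_graded_family:
  fixes A :: "nat \<Rightarrow> ('v::finite, 'k::field) mpol set"
  assumes graded: "\<And>k. A k \<subseteq> graded k" and indep: "\<And>k. K.independent (A k)"
  shows "K.independent (\<Union>k. A k)"
  unfolding K.independent_explicit_module
proof clarify
  fix t :: "('v, 'k) mpol set" and u v
  assume t: "finite t" "t \<subseteq> (\<Union>k. A k)" and 0: "(\<Sum>v\<in>t. kscale (u v) v) = 0"
    and "v \<in> t"
  then obtain k where v: "v \<in> t" "v \<in> A k" by auto
  have part: "hom_part k w = (if w \<in> A k then w else 0)" if "w \<in> t" for w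
  proof -
    obtain l where l: "w \<in> A l" using t(2) \<open>w \<in> t\<close> by blast
    have "w \<noteq> 0" using l indep[of l] K.dependent_zero by blast
    show ?thesis
    proof (cases "w \<in> A k")
      case True
      then show ?thesis using hom_part_graded[of w k k] graded by auto
    next
      case False
      then show ?thesis using hom_part_graded[of w l k] graded[of l] l by auto
    qed
  qed
  have "0 = hom_part k (\<Sum>v\<in>t. kscale (u v) v)" by (simp add: 0)
  also have "\<dots> = (\<Sum>w\<in>t. if w \<in> A k then kscale (u w) w else 0)"
    unfolding hom_part_sum hom_part_kscale by (intro sum.cong refl) (simp add: part)
  also have "\<dots> = (\<Sum>w\<in>t \<inter> A k. kscale (u w) w)"
    using t(1) by (simp add: sum.inter_restrict)
  finally show "u v = 0"
    using K.independentD[OF indep[of k], of "t \<inter> A k" u v] t(1) v by simp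
qed

section \<open>The complement of an ideal up to a degree\<close>

text \<open>
  For a homogeneous ideal \<open>J\<close> this is the sum of \<open>J\<close> and the span of the monomials of degree greater than \<open>s\<close>.
\<close>

definition truncated_ideal :: "('v::finite, 'k::field) mpol set \<Rightarrow> nat \<Rightarrow> ('v, 'k) mpol set" where
  "truncated_ideal J s = {p. \<forall>k\<le>s. hom_part k p \<in> J}"

locale ideal_complement =
  fixes J :: "('v::finite, 'k::field) mpol set" and s :: nat and N V :: "nat \<Rightarrow> ('v, 'k) mpol set"
  assumes ideal: "module.subspace (*) J" and proper: "J \<noteq> UNIV"
    and complement: "complement_upto J s N"
    and basis: "k \<in> {1..s} \<Longrightarrow> is_K_basis (V k) (J \<inter> graded k \<inter> K.span (plus_set (N (k - 1))))"
begin

abbreviation "I \<equiv> truncated_ideal J s"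
abbreviation "B \<equiv> \<Union>k\<le>s. N k"
abbreviation "E \<equiv> (\<Union>k\<in>{1..s}. V k) \<union> plus_set (N s)"

lemma J_simps: "0 \<in> J" "p \<in> J \<Longrightarrow> q \<in> J \<Longrightarrow> p + q \<in> J" "p \<in> J \<Longrightarrow> r * p \<in> J"
    "p \<in> J \<Longrightarrow> kscale c p \<in> J"
proof -
  interpret P: module "(*) :: ('v, 'k) mpol \<Rightarrow> _" by (rule module_times)
  show "0 \<in> J" "p \<in> J \<Longrightarrow> q \<in> J \<Longrightarrow> p + q \<in> J" "p \<in> J \<Longrightarrow> r * p \<in> J" "p \<in> J \<Longrightarrow> kscale c p \<in> J"
    using ideal by (auto simp: kscale_def intro: P.subspace_0 P.subspace_add P.subspace_scale)
qed

lemma truncated_ideal_ideal: "module.subspace (*) I"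
proof -
  show ?thesis
  proof (rule module.subspaceI[OF module_times])
    show "0 \<in> I" by (simp add: truncated_ideal_def J_simps)
    show add: "p + q \<in> I" if "p \<in> I" "q \<in> I" for p q
      using that by (simp add: truncated_ideal_def hom_part_add J_simps)
    show "r * p \<in> I" if "p \<in> I" for r p
    proof (induction r rule: mpol_var_induct)
      case (const c)
      have "kscale c p \<in> I" using that by (simp add: truncated_ideal_def hom_part_kscale J_simps)
      then show ?case by (simp add: kscale_def)
    next
      case (var j r)
      have "hom_part k (var j * (r * p)) \<in> J" if "k \<le> s" for k
        using var that
        by (cases k) (simp_all add: truncated_ideal_def hom_part_var_0 hom_part_var_Suc J_simps)
      then show ?case by (simp add: truncated_ideal_def mult.assoc)
    qed (simp add: distrib_right add)
  qed
qed

lemma K_subspace_I: "K.subspace I"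
  by (rule K.subspaceI) (simp_all add: truncated_ideal_def hom_part_add hom_part_kscale J_simps)

lemma in_I_if_in_J: "p \<in> J \<Longrightarrow> p \<in> graded k \<Longrightarrow> p \<in> I"
  by (simp add: truncated_ideal_def hom_part_graded J_simps)

lemma in_I_if_degree_gt: "p \<in> graded k \<Longrightarrow> s < k \<Longrightarrow> p \<in> I"
  by (simp add: truncated_ideal_def hom_part_graded J_simps)

lemma monoms_0: "monoms 0 = ({1} :: ('v, 'k) mpol set)"
  by (auto simp: monoms_def exp_degree_eq_0_iff)

lemma complement_upto:
  shows N_0: "N 0 = {1}"
    and N_plus: "k < s \<Longrightarrow> N (Suc k) \<subseteq> plus_set (N k)"
    and N_direct: "\<lbrakk>k \<le> s; k \<noteq> 0\<rbrakk> \<Longrightarrow> direct_sum (graded k) (J \<inter> graded k) (K.span (N k))"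
    and N_monoms: "k \<le> s \<Longrightarrow> N k \<subseteq> monoms k"
proof -
  have *: "N k \<subseteq> monoms k \<and> N k \<subseteq> plus_set (N (k - 1)) \<and>
      direct_sum (graded k) (J \<inter> graded k) (K.span (N k))" if "k \<in> {1..s}" for k
    using complement that unfolding complement_upto_def by blast
  show 0: "N 0 = {1}" using complement unfolding complement_upto_def by blast
  show "k < s \<Longrightarrow> N (Suc k) \<subseteq> plus_set (N k)" using *[of "Suc k"] by simp
  show "\<lbrakk>k \<le> s; k \<noteq> 0\<rbrakk> \<Longrightarrow> direct_sum (graded k) (J \<inter> graded k) (K.span (N k))"
    using *[of k] by simp
  show "k \<le> s \<Longrightarrow> N k \<subseteq> monoms k"
    using *[of k] 0 by (cases "k = 0") (simp_all add: monoms_0)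
qed

lemma span_N_graded: "k \<le> s \<Longrightarrow> K.span (N k) \<subseteq> graded k"
  unfolding graded_def by (intro K.span_mono N_monoms)

text \<open>
  In degree \<open>0\<close>, which the definition of a complement leaves out, the constants are spanned by \<open>N\<^sub>0\<close>.
\<close>

lemma graded_decomp:
  assumes "k \<le> s" "p \<in> graded k"
  shows "\<exists>a b. p = a + b \<and> a \<in> J \<inter> graded k \<and> b \<in> K.span (N k)"
proof (cases "k = 0")
  case True
  then have "K.span (N k) = graded k"
    by (simp add: N_0 graded_def monoms_0)
  with assms True show ?thesis by (intro exI[of _ 0] exI[of _ p]) (simp add: J_simps graded_def K.span_zero)
next
  case False
  with assms have "direct_sum (graded k) (J \<inter> graded k) (K.span (N k))" by (simp add: N_direct)
  with assms(2) show ?thesis unfolding direct_sum_def by blast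
qed

text \<open>
  In degree \<open>0\<close> this is properness of \<open>J\<close>, which then contains no nonzero constant.
\<close>

lemma J_inter_span_N:
  assumes "k \<le> s" "p \<in> J" "p \<in> K.span (N k)"
  shows "p = 0"
proof (cases "k = 0")
  case True
  then have "p \<in> K.span {1}" using assms by (simp add: N_0)
  then obtain c where p: "p = kscale c 1" unfolding K.span_singleton by blast
  have "c = 0"
  proof (rule ccontr)
    assume "c \<noteq> 0"
    then have "kscale (inverse c) p = 1" by (simp add: p)
    then have "1 \<in> J" using J_simps(4)[OF assms(2), of "inverse c"] by simp
    then have "r \<in> J" for r using J_simps(3)[of 1 r] by simp
    with proper show False by auto
  qed
  then show ?thesis by (simp add: p)
next
  case False
  with assms have "J \<inter> graded k \<inter> K.span (N k) = {0}"
    using N_direct unfolding direct_sum_def by blast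
  with assms span_N_graded show ?thesis by blast
qed

lemma hom_part_span_B:
  assumes "p \<in> K.span B"
  shows "hom_part k p \<in> K.span (if k \<le> s then N k else {})"
  using assms
proof (induction rule: K.span_induct_alt)
  case (step c x y)
  then obtain l where l: "l \<le> s" "x \<in> N l" by auto
  then have "hom_part k x = (if k = l then x else 0)"
    using N_monoms[of l] by (intro hom_part_graded) (auto simp: graded_def intro: K.span_base)
  then have "hom_part k x \<in> K.span (if k \<le> s then N k else {})"
    using l by (auto simp: K.span_zero intro: K.span_base)
  with step(2) show ?case by (simp only: hom_part_add hom_part_kscale K.span_add K.span_scale)
qed (simp add: K.span_zero)

lemma I_inter_span_B: "I \<inter> K.span B = {0}"
proof -
  have "p = 0" if "p \<in> I" "p \<in> K.span B" for p
  proof (rule eq_0_if_hom_parts_0)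
    fix k show "hom_part k p = 0"
      using hom_part_span_B[OF that(2), of k] that(1) J_inter_span_N[of k "hom_part k p"]
      by (cases "k \<le> s") (auto simp: truncated_ideal_def)
  qed
  then show ?thesis using K.subspace_0[OF K_subspace_I] by (auto simp: K.span_zero)
qed

lemma span_N_subset_span_B: "k \<le> s \<Longrightarrow> K.span (N k) \<subseteq> K.span B"
  by (rule K.span_mono) auto

lemma direct_sum_I_B: "direct_sum UNIV I (K.span B)"
proof -
  have "\<exists>a b. p = a + b \<and> a \<in> I \<and> b \<in> K.span B" for p
  proof (induction p rule: mpol_sum_induct)
    case (monomial m c)
    let ?p = "Poly_Mapping.single m c :: ('v, 'k) mpol" and ?k = "exp_degree m"
    have "?p = kscale c (Poly_Mapping.single m 1)" by (simp add: kscale_def mult_single)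
    moreover have "Poly_Mapping.single m 1 \<in> (graded ?k :: ('v, 'k) mpol set)"
      by (auto simp: graded_def monoms_def intro: K.span_base)
    ultimately have p: "?p \<in> graded ?k" by (simp add: graded_def K.span_scale)
    show ?case
    proof (cases "?k \<le> s")
      case True
      then obtain a b where "?p = a + b" "a \<in> J" "a \<in> graded ?k" "b \<in> K.span (N ?k)"
        using graded_decomp[OF _ p] by auto
      then show ?thesis using in_I_if_in_J span_N_subset_span_B[OF True] by blast
    next
      case False
      then have "?p \<in> I" using in_I_if_degree_gt p by auto
      then show ?thesis by (intro exI[of _ ?p] exI[of _ 0]) (simp add: K.span_zero)
    qed
  next
    case (add p q)
    then obtain a b a' b' where "p = a + b" "a \<in> I" "b \<in> K.span B" "q = a' + b'" "a' \<in> I" "b' \<in> K.span B"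
      by blast
    then have "p + q = (a + a') + (b + b')" "a + a' \<in> I" "b + b' \<in> K.span B"
      using K.subspace_add[OF K_subspace_I] by (simp_all add: K.span_add)
    then show ?case by blast
  qed
  then show ?thesis using I_inter_span_B by (auto simp: direct_sum_def)
qed

lemma B_connected: "B \<subseteq> connected_to_one B"
proof -
  have "N k \<subseteq> connected_to_one B" if "k \<le> s" for k
    using that
  proof (induction k)
    case 0
    have "1 \<in> B" using N_0 by blast
    then show ?case using N_0 connected_to_one.one[of B] by simp
  next
    case (Suc k)
    show ?case
    proof
      fix x assume x: "x \<in> N (Suc k)"
      then obtain j n where n: "x = var j * n" "n \<in> N k"
        using N_plus[of k] Suc.prems by (auto simp: plus_set_def)
      have "x \<in> B" using x Suc.prems by blast
      then show "x \<in> connected_to_one B"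
        using n Suc connected_to_one.step[of n B j] by auto
    qed
  qed
  then show ?thesis by auto
qed

lemma V:
  assumes "k \<in> {1..s}"
  shows "K.independent (V k)" "K.span (V k) = J \<inter> graded k \<inter> K.span (plus_set (N (k - 1)))"
    and "V k \<subseteq> J \<inter> graded k \<inter> K.span (plus_set (N (k - 1)))"
  using basis[OF assms] K.span_superset[of "V k"] by (auto simp: is_K_basis_def)

lemma plus_set_N_monoms: "plus_set (N s) \<subseteq> monoms (Suc s)"
  by (intro plus_set_monoms N_monoms) simp

lemma independent_E: "K.independent E"
proof -
  define A where "A k = (if k \<in> {1..s} then V k else if k = Suc s then plus_set (N s) else {})" for k
  have "K.independent (plus_set (N s))"
    by (rule K.independent_mono[OF independent_monomials])
      (use plus_set_N_monoms in \<open>auto simp: monoms_def\<close>)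
  then have "K.independent (\<Union>k. A k)"
    using V(1) V(3) plus_set_N_monoms
    by (intro independent_graded_family) (auto simp: A_def graded_def K.independent_empty intro: K.span_base)
  moreover have "(\<Union>k. A k) = E" by (auto simp: A_def split: if_splits)
  ultimately show ?thesis by simp
qed

lemma finite_E: "finite E"
proof -
  have mon: "finite (monoms k :: ('v, 'k) mpol set)" for k
  proof -
    have "monoms k = (\<lambda>m. Poly_Mapping.single m 1 :: ('v, 'k) mpol) ` {m. exp_degree m = k}"
      by (auto simp: monoms_def)
    then show ?thesis by (simp add: finite_exp_degree)
  qed
  have "finite (V k)" if "k \<in> {1..s}" for k
  proof -
    have "V k \<subseteq> K.span (monoms k)" using V(3)[OF that] unfolding graded_def by blast
    then show ?thesis using K.independent_span_bound[OF mon[of k] V(1)[OF that]] by blast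
  qed
  moreover have "finite (plus_set (N s))"
    using plus_set_N_monoms mon finite_subset by blast
  ultimately show ?thesis by simp
qed

lemma span_E_subset: "K.span E \<subseteq> I \<inter> K.span (B \<union> plus_set B)"
proof (rule K.span_minimal)
  have plus: "K.span (plus_set (N k)) \<subseteq> K.span (B \<union> plus_set B)" if "k \<le> s" for k
    using that by (intro K.span_mono) (auto simp: plus_set_def)
  have "V k \<subseteq> I \<inter> K.span (B \<union> plus_set B)" if "k \<in> {1..s}" for k
  proof
    fix x assume "x \<in> V k"
    then have x: "x \<in> J" "x \<in> graded k" "x \<in> K.span (plus_set (N (k - 1)))"
      using V(3)[OF that] by auto
    have "k - 1 \<le> s" using that by auto
    with x show "x \<in> I \<inter> K.span (B \<union> plus_set B)" using plus in_I_if_in_J by blast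
  qed
  moreover have "plus_set (N s) \<subseteq> I"
    using plus_set_N_monoms in_I_if_degree_gt[of _ "Suc s"] by (auto simp: graded_def intro: K.span_base)
  moreover have "plus_set (N s) \<subseteq> K.span (B \<union> plus_set B)"
    using plus[of s] K.span_superset by blast
  ultimately show "E \<subseteq> I \<inter> K.span (B \<union> plus_set B)" by blast
  show "K.subspace (I \<inter> K.span (B \<union> plus_set B))"
    by (intro K.subspace_inter K_subspace_I K.subspace_span)
qed

text \<open>
  A product \<open>x\<^sub>j n\<close> with \<open>n\<close> in \<open>N\<^sub>k\<close>, \<open>k < s\<close>, is the sum of an element of \<open>J\<close> and one of the span of
  \<open>N\<^bsub>k+1\<^esub>\<close>. Because \<open>N\<^bsub>k+1\<^esub> \<subseteq> N\<^sub>k\<^sup>+\<close>, the former lies in the span of \<open>N\<^sub>k\<^sup>+\<close> as well, hence in that of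
  \<open>V\<^bsub>k+1\<^esub>\<close>. For \<open>k = s\<close> the product belongs to the family itself.
\<close>

lemma reduce_border:
  assumes "p \<in> K.span (B \<union> plus_set B)"
  shows "\<exists>u\<in>K.span B. p - u \<in> K.span E"
  using assms
proof (induction rule: K.span_induct_alt)
  case base
  show ?case by (intro bexI[of _ 0]) (simp_all add: K.span_zero)
next
  case (step c x y)
  have "\<exists>u\<in>K.span B. x - u \<in> K.span E"
  proof (cases "x \<in> B")
    case True
    then show ?thesis by (intro bexI[of _ x]) (simp_all add: K.span_zero K.span_base)
  next
    case False
    then obtain j n k where n: "k \<le> s" "n \<in> N k" "x = var j * n"
      using step(1) by (auto simp: plus_set_def)
    then have x: "x \<in> plus_set (N k)" by (auto simp: plus_set_def)
    show ?thesis
    proof (cases "k = s")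
      case True
      then show ?thesis using x by (intro bexI[of _ 0]) (auto simp: K.span_zero intro: K.span_base)
    next
      case False
      then have k: "Suc k \<le> s" using n(1) by simp
      have "n \<in> graded k" using n N_monoms unfolding graded_def by (blast intro: K.span_base)
      then have "x \<in> graded (Suc k)" using n(3) var_mult_graded by blast
      then obtain a b where ab: "x = a + b" "a \<in> J \<inter> graded (Suc k)" "b \<in> K.span (N (Suc k))"
        using graded_decomp[OF k] by blast
      have "b \<in> K.span (plus_set (N k))"
        using ab(3) K.span_mono[OF N_plus[of k]] k by auto
      then have "a \<in> K.span (plus_set (N k))"
        using K.span_diff[OF K.span_base[OF x], of b] ab(1) by simp
      then have "a \<in> K.span (V (Suc k))" using V(2)[of "Suc k"] k ab(2) by auto
      then have "a \<in> K.span E" using K.span_mono[of "V (Suc k)" E] k by fastforce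
      then show ?thesis
        using ab span_N_subset_span_B[OF k] by (intro bexI[of _ b]) auto
    qed
  qed
  then obtain u where u: "u \<in> K.span B" "x - u \<in> K.span E" by blast
  obtain v where v: "v \<in> K.span B" "y - v \<in> K.span E" using step(2) by blast
  have "kscale c x + y - (kscale c u + v) = kscale c (x - u) + (y - v)"
    by (simp add: K.scale_right_diff_distrib)
  with u v show ?case
    by (intro bexI[of _ "kscale c u + v"]) (simp_all only: K.span_add K.span_scale)
qed

text \<open>
  An element of \<open>I\<close> reduces modulo the span of the family to an element of \<open>I \<inter> B = 0\<close>.
\<close>

lemma span_E: "K.span E = I \<inter> K.span (B \<union> plus_set B)"
proof (intro equalityI span_E_subset subsetI)
  fix p assume p: "p \<in> I \<inter> K.span (B \<union> plus_set B)"
  then obtain u where u: "u \<in> K.span B" "p - u \<in> K.span E" using reduce_border by blast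
  have "p - u \<in> I" using u(2) span_E_subset by blast
  then have "u \<in> I" using K.subspace_diff[OF K_subspace_I, of p "p - u"] p by simp
  then have "u = 0" using u(1) I_inter_span_B by blast
  then show "p \<in> K.span E" using u(2) by simp
qed

end

theorem proposition2p11:
  fixes J :: "('v::finite, 'k::alg_closed_field) mpol set"
    and s :: nat
    and N V :: "nat \<Rightarrow> ('v, 'k) mpol set"
  assumes "homogeneous_ideal J" and "J \<noteq> UNIV"
    and "s \<ge> 1"
    and "complement_upto J s N"
    and "\<And>k. k \<in> {1..s} \<Longrightarrow> is_K_basis (V k) (J \<inter> graded k \<inter> K.span (plus_set (N (k - 1))))"
  shows "finite ((\<Union>k\<in>{1..s}. V k) \<union> plus_set (N s)) \<and>
    (\<forall>h F. bij_betw F {1..h} ((\<Union>k\<in>{1..s}. V k) \<union> plus_set (N s)) \<longrightarrow>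
      (\<exists>G. (\<forall>g\<in>G. \<forall>i\<in>{1..h}. total_degree (g i) \<le> 1) \<and> vec.span G = syz h F))"
proof -
  interpret ideal_complement J s N V
    using assms by unfold_locales (auto simp: homogeneous_ideal_def)
  have "\<exists>G. (\<forall>g\<in>G. \<forall>i\<in>{1..h}. total_degree (g i) \<le> 1) \<and> vec.span G = syz h F"
    if "bij_betw F {1..h} E" for h F
  proof -
    interpret border_basis I B E h F
      using truncated_ideal_ideal direct_sum_I_B B_connected independent_E span_E that
      by unfold_locales
    show ?thesis
      by (rule exI[of _ linear_syz]) (rule conjI[OF _ span_linear_syz], simp add: linear_syz_def)
  qed
  with finite_E show ?thesis by blast
qed

end
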